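(* Let $\theta,\eta\in\mathbb R$. For all $\mu,\nu,\iota,\lambda\in\mathbb P_\varepsilon$, the product in ${}^*\mathbb Z$ satisfies $${}^*\mathbb Z^{\mu[\iota]}_\nu(\theta)\cdot{}^*\mathbb Z^{\nu[\lambda]}_\mu(\eta)\ \subset\ {}^*\mathbb Z^{\mu\cdot\nu[\iota\cdot\lambda]}_{\iota+\lambda}(\theta\eta)\ \cap\ {}^*\mathbb Z^{\mu\cdot\nu[\iota\cdot\lambda]}_{\iota+\lambda}(\theta+\eta)\ \cap\ {}^*\mathbb Z^{\mu\cdot\nu[\iota\cdot\lambda]}_{\iota+\lambda}(\theta-\eta).$$ In particular, ${}^*\mathbb Z^{\mu}_\nu(\theta)\cdot{}^*\mathbb Z^{\nu}_\mu(\eta)\subset{}^*\mathbb Z^{\mu\cdot\nu}(\theta\eta)\cap{}^*\mathbb Z^{\mu\cdot\nu}(\theta+\eta)\cap{}^*\mathbb Z^{\mu\cdot\nu}(\theta-\eta)$. Moreover, for $m\in{}^*\mathbb Z^\mu_\nu(\theta)$ and $n\in{}^*\mathbb Z^\nu_\mu(\eta)$, $$(mn)^{\perp_{\theta\eta}}=m^{\perp_\theta}n^{\perp_\eta}\quad\text{and}\quad(mn)^{\perp_{\theta\pm\eta}}=m^{\perp_\theta}n\pm m\,n^{\perp_\eta}.$$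
   Context: Fix a nonprincipal ultrafilter $\mathfrak u$ on $\mathbb N$, and let ${}^*\mathbb Z\subset{}^*\mathbb R$ be the ultrapowers of $\mathbb Z\subset\mathbb R$. Let ${}^*\mathbb R_{\rm fin}$ be the ring of bounded elements, ${}^*\mathbb R_\varepsilon$ its ideal of infinitesimals, and $({}^*\mathbb R_{\rm fin})^\times_+$ the multiplicative group of positive elements that are neither infinite nor infinitesimal. Let $\mathbb P:=({}^*\mathbb R_{>0}\cup\{0\})/({}^*\mathbb R_{\rm fin})^\times_+$; write $\langle x\rangle\in\mathbb P$ for the class of $|x|$, and $-\infty:=\langle0\rangle$. $\mathbb P$ has the induced product and total order ($\mu<\mu'$ iff $x<x'$ for all representatives; $-\infty$ is the minimum), the sum $\mu+\nu:=\max(\mu,\nu)$, and $|n|\cdot\mu:=\langle n\rangle\cdot\mu$ for $n\in{}^*\mathbb Z$. $\mathbb P_\varepsilon\subset\mathbb P$ is the set of classes of positive infinitesimals. For $\mu,\iota\in\mathbb P_\varepsilon$: ${}^*\mathbb Z^\mu:=\{n\in{}^*\mathbb Z: n=0\text{ or }\langle n\rangle^{-1}>\mu\}$ and ${}^*\mathbb Z^{\mu[\iota]}:=\{n\in{}^*\mathbb Z:|n|\cdot\mu<\iota\}$. For $\theta\in\mathbb R$, ${}^*\mathbb Z(\theta)$ is the group of $n\in{}^*\mathbb Z$ for which there is $n^\perp=n^{\perp_\theta}\in{}^*\mathbb Z$ (necessarily unique, called the $\theta$-dual of $n$) with $\varepsilon(n):=n\theta-n^\perp\in{}^*\mathbb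 R_\varepsilon$. For $\nu\in\mathbb P_\varepsilon$, ${}^*\mathbb Z_\nu(\theta):=\{n\in{}^*\mathbb Z(\theta):\langle\varepsilon(n)\rangle\le\nu\}$. Put ${}^*\mathbb Z^\mu(\theta):={}^*\mathbb Z^\mu\cap{}^*\mathbb Z(\theta)$, ${}^*\mathbb Z^\mu_\nu(\theta):={}^*\mathbb Z^\mu\cap{}^*\mathbb Z_\nu(\theta)$, ${}^*\mathbb Z^{\mu[\iota]}_\nu(\theta):={}^*\mathbb Z^{\mu[\iota]}\cap{}^*\mathbb Z_\nu(\theta)$. *)

theory Defs
  imports Complex_Main
begin

section \<open>Ultrapowers\<close>

definition nonprincipal_ultrafilter :: "nat filter \<Rightarrow> bool" where
  "nonprincipal_ultrafilter U \<longleftrightarrow>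
     U \<noteq> bot \<and> (\<forall>P. eventually P U \<or> eventually (\<lambda>i. \<not> P i) U) \<and> (\<forall>k. U \<noteq> principal {k})"

definition ultra_rel :: "nat filter \<Rightarrow> ((nat \<Rightarrow> 'a) \<times> (nat \<Rightarrow> 'a)) set" where
  "ultra_rel U = {(x, y). eventually (\<lambda>i. x i = y i) U}"

definition ultra_class :: "nat filter \<Rightarrow> (nat \<Rightarrow> 'a) \<Rightarrow> (nat \<Rightarrow> 'a) set" where
  "ultra_class U x = ultra_rel U `` {x}"

text \<open>The ultrapower of a set \<open>A\<close>, regarded as a subset of the ultrapower of the
  whole type. The ultrafilter is a parameter, so ultrapowers are carrier sets rather than types.\<close>

definition ultrapower :: "nat filter \<Rightarrow> 'a set \<Rightarrow> (nat \<Rightarrow> 'a) set set" where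
  "ultrapower U A = {ultra_class U x | x. \<forall>i. x i \<in> A}"

type_synonym hyperreal = "(nat \<Rightarrow> real) set"

definition hreals :: "nat filter \<Rightarrow> hyperreal set" where
  "hreals U = ultrapower U UNIV"

definition hints :: "nat filter \<Rightarrow> hyperreal set" where
  "hints U = ultrapower U \<int>"

definition hconst :: "nat filter \<Rightarrow> real \<Rightarrow> hyperreal" where
  "hconst U r = ultra_class U (\<lambda>_. r)"

definition hlift :: "nat filter \<Rightarrow> (real \<Rightarrow> real) \<Rightarrow> hyperreal \<Rightarrow> hyperreal" where
  "hlift U f X = (\<Union>x\<in>X. ultra_class U (\<lambda>i. f (x i)))"

definition hlift2 :: "nat filter \<Rightarrow> (real \<Rightarrow> real \<Rightarrow> real) \<Rightarrow> hyperreal \<Rightarrow> hyperreal \<Rightarrow> hyperreal" where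
  "hlift2 U f X Y = (\<Union>x\<in>X. \<Union>y\<in>Y. ultra_class U (\<lambda>i. f (x i) (y i)))"

definition habs :: "nat filter \<Rightarrow> hyperreal \<Rightarrow> hyperreal" where
  "habs U = hlift U abs"

definition hinv :: "nat filter \<Rightarrow> hyperreal \<Rightarrow> hyperreal" where
  "hinv U = hlift U inverse"

definition hadd :: "nat filter \<Rightarrow> hyperreal \<Rightarrow> hyperreal \<Rightarrow> hyperreal" where
  "hadd U = hlift2 U (+)"

definition hsub :: "nat filter \<Rightarrow> hyperreal \<Rightarrow> hyperreal \<Rightarrow> hyperreal" where
  "hsub U = hlift2 U (-)"

definition hmul :: "nat filter \<Rightarrow> hyperreal \<Rightarrow> hyperreal \<Rightarrow> hyperreal" where
  "hmul U = hlift2 U (*)"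

definition hless :: "nat filter \<Rightarrow> hyperreal \<Rightarrow> hyperreal \<Rightarrow> bool" where
  "hless U X Y \<longleftrightarrow> (\<exists>x\<in>X. \<exists>y\<in>Y. eventually (\<lambda>i. x i < y i) U)"

definition hfin :: "nat filter \<Rightarrow> hyperreal set" where
  "hfin U = {x \<in> hreals U. \<exists>r. hless U (habs U x) (hconst U r)}"

definition hinfinitesimal :: "nat filter \<Rightarrow> hyperreal set" where
  "hinfinitesimal U = {x \<in> hreals U. \<forall>r>0. hless U (habs U x) (hconst U r)}"

definition hfin_units_pos :: "nat filter \<Rightarrow> hyperreal set" where
  "hfin_units_pos U = {x \<in> hfin U. hless U (hconst U 0) x \<and> x \<notin> hinfinitesimal U}"

section \<open>The growth-decay semiring \<open>\<bbbP>\<close>\<close>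

definition hnonneg :: "nat filter \<Rightarrow> hyperreal set" where
  "hnonneg U = {x \<in> hreals U. hless U (hconst U 0) x} \<union> {hconst U 0}"

definition pp_rel :: "nat filter \<Rightarrow> (hyperreal \<times> hyperreal) set" where
  "pp_rel U = {(x, y). x \<in> hnonneg U \<and> y \<in> hnonneg U \<and> (\<exists>u\<in>hfin_units_pos U. y = hmul U u x)}"

definition PP :: "nat filter \<Rightarrow> hyperreal set set" where
  "PP U = hnonneg U // pp_rel U"

definition pp_class :: "nat filter \<Rightarrow> hyperreal \<Rightarrow> hyperreal set" where
  "pp_class U x = pp_rel U `` {habs U x}"

definition PP_eps :: "nat filter \<Rightarrow> hyperreal set set" where
  "PP_eps U = {pp_class U x | x. x \<in> hinfinitesimal U \<and> hless U (hconst U 0) x}"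

definition pp_mul :: "nat filter \<Rightarrow> hyperreal set \<Rightarrow> hyperreal set \<Rightarrow> hyperreal set" where
  "pp_mul U M N = (\<Union>x\<in>M. \<Union>y\<in>N. pp_class U (hmul U x y))"

text \<open>Only meaningful for classes other than \<open>-\<infinity> = pp_class U (hconst U 0)\<close>.\<close>

definition pp_inv :: "nat filter \<Rightarrow> hyperreal set \<Rightarrow> hyperreal set" where
  "pp_inv U M = (\<Union>x\<in>M. pp_class U (hinv U x))"

definition pp_less :: "nat filter \<Rightarrow> hyperreal set \<Rightarrow> hyperreal set \<Rightarrow> bool" where
  "pp_less U M N \<longleftrightarrow> (\<forall>x\<in>M. \<forall>y\<in>N. hless U x y)"

definition pp_le :: "nat filter \<Rightarrow> hyperreal set \<Rightarrow> hyperreal set \<Rightarrow> bool" where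
  "pp_le U M N \<longleftrightarrow> pp_less U M N \<or> M = N"

text \<open>The sum in \<open>\<bbbP>\<close> is the maximum.\<close>

definition pp_add :: "nat filter \<Rightarrow> hyperreal set \<Rightarrow> hyperreal set \<Rightarrow> hyperreal set" where
  "pp_add U M N = (if pp_le U M N then N else M)"

section \<open>Growth filtrations and diophantine approximation groups\<close>

text \<open>\<open>hints_growth U \<mu>\<close> is \<open>*\<int>\<^sup>\<mu>\<close> and \<open>hints_fine U \<mu> \<iota>\<close> is \<open>*\<int>\<^sup>\<mu>\<^sup>[\<^sup>\<iota>\<^sup>]\<close>.\<close>

definition hints_growth :: "nat filter \<Rightarrow> hyperreal set \<Rightarrow> hyperreal set" where
  "hints_growth U \<mu> = {n \<in> hints U. n = hconst U 0 \<or> pp_less U \<mu> (pp_inv U (pp_class U n))}"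

definition hints_fine :: "nat filter \<Rightarrow> hyperreal set \<Rightarrow> hyperreal set \<Rightarrow> hyperreal set" where
  "hints_fine U \<mu> \<iota> = {n \<in> hints U. pp_less U (pp_mul U (pp_class U n) \<mu>) \<iota>}"

text \<open>\<open>is_dual U \<theta> n p\<close>: \<open>p\<close> is a \<open>\<theta>\<close>-dual of \<open>n\<close>; it is unique by \<open>is_dual_unique\<close> below,
  so that the description in \<open>dual\<close> is proper on \<open>*\<int>(\<theta>)\<close>.\<close>

definition is_dual :: "nat filter \<Rightarrow> real \<Rightarrow> hyperreal \<Rightarrow> hyperreal \<Rightarrow> bool" where
  "is_dual U \<theta> n p \<longleftrightarrow> p \<in> hints U \<and> hsub U (hmul U n (hconst U \<theta>)) p \<in> hinfinitesimal U"

definition dual :: "nat filter \<Rightarrow> real \<Rightarrow> hyperreal \<Rightarrow> hyperreal" where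
  "dual U \<theta> n = (THE p. is_dual U \<theta> n p)"

definition dual_error :: "nat filter \<Rightarrow> real \<Rightarrow> hyperreal \<Rightarrow> hyperreal" where
  "dual_error U \<theta> n = hsub U (hmul U n (hconst U \<theta>)) (dual U \<theta> n)"

definition dioph :: "nat filter \<Rightarrow> real \<Rightarrow> hyperreal set" where
  "dioph U \<theta> = {n \<in> hints U. \<exists>p. is_dual U \<theta> n p}"

definition dioph_decay :: "nat filter \<Rightarrow> hyperreal set \<Rightarrow> real \<Rightarrow> hyperreal set" where
  "dioph_decay U \<nu> \<theta> = {n \<in> dioph U \<theta>. pp_le U (pp_class U (dual_error U \<theta> n)) \<nu>}"

text \<open>\<open>*\<int>\<^sup>\<mu>(\<theta>)\<close>, \<open>*\<int>\<^sup>\<mu>\<^sub>\<nu>(\<theta>)\<close> and \<open>*\<int>\<^sup>\<mu>\<^sup>[\<^sup>\<iota>\<^sup>]\<^sub>\<nu>(\<theta>)\<close>, in this order.\<close>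

definition dioph_growth :: "nat filter \<Rightarrow> hyperreal set \<Rightarrow> real \<Rightarrow> hyperreal set" where
  "dioph_growth U \<mu> \<theta> = hints_growth U \<mu> \<inter> dioph U \<theta>"

definition dioph_growth_decay ::
    "nat filter \<Rightarrow> hyperreal set \<Rightarrow> hyperreal set \<Rightarrow> real \<Rightarrow> hyperreal set" where
  "dioph_growth_decay U \<mu> \<nu> \<theta> = hints_growth U \<mu> \<inter> dioph_decay U \<nu> \<theta>"

definition dioph_fine ::
    "nat filter \<Rightarrow> hyperreal set \<Rightarrow> hyperreal set \<Rightarrow> hyperreal set \<Rightarrow> real \<Rightarrow> hyperreal set" where
  "dioph_fine U \<mu> \<iota> \<nu> \<theta> = hints_fine U \<mu> \<iota> \<inter> dioph_decay U \<nu> \<theta>"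

definition set_hmul :: "nat filter \<Rightarrow> hyperreal set \<Rightarrow> hyperreal set \<Rightarrow> hyperreal set" where
  "set_hmul U A B = {hmul U a b | a b. a \<in> A \<and> b \<in> B}"

section \<open>Computing with representatives\<close>

lemma ultra_class_eq_iff:
  "ultra_class U x = ultra_class U y \<longleftrightarrow> eventually (\<lambda>i. x i = y i) U"
proof
  assume "ultra_class U x = ultra_class U y"
  moreover have "y \<in> ultra_class U y" by (simp add: ultra_class_def ultra_rel_def)
  ultimately have "y \<in> ultra_class U x" by simp
  then show "eventually (\<lambda>i. x i = y i) U" by (simp add: ultra_class_def ultra_rel_def)
next
  assume e: "eventually (\<lambda>i. x i = y i) U"
  have "eventually (\<lambda>i. x i = z i) U \<longleftrightarrow> eventually (\<lambda>i. y i = z i) U" for z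
    by (rule eventually_subst) (use e in eventually_elim, simp)
  then show "ultra_class U x = ultra_class U y" by (auto simp: ultra_class_def ultra_rel_def)
qed

lemma mem_ultra_class: "y \<in> ultra_class U x \<longleftrightarrow> eventually (\<lambda>i. x i = y i) U"
  by (simp add: ultra_class_def ultra_rel_def)

lemma hlift_class: "hlift U f (ultra_class U x) = ultra_class U (\<lambda>i. f (x i))"
proof -
  have "ultra_class U (\<lambda>i. f (x' i)) = ultra_class U (\<lambda>i. f (x i))" if "x' \<in> ultra_class U x" for x'
    using that unfolding ultra_class_eq_iff mem_ultra_class by eventually_elim simp
  moreover have "x \<in> ultra_class U x" by (simp add: mem_ultra_class)
  ultimately show ?thesis unfolding hlift_def by blast
qed

lemma hlift2_class:
  "hlift2 U f (ultra_class U x) (ultra_class U y) = ultra_class U (\<lambda>i. f (x i) (y i))"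
proof -
  have "ultra_class U (\<lambda>i. f (x' i) (y' i)) = ultra_class U (\<lambda>i. f (x i) (y i))"
    if "x' \<in> ultra_class U x" "y' \<in> ultra_class U y" for x' y'
    using that unfolding ultra_class_eq_iff mem_ultra_class by eventually_elim simp
  moreover have "x \<in> ultra_class U x" "y \<in> ultra_class U y" by (simp_all add: mem_ultra_class)
  ultimately show ?thesis unfolding hlift2_def by blast
qed

lemma hless_class:
  "hless U (ultra_class U x) (ultra_class U y) \<longleftrightarrow> eventually (\<lambda>i. x i < y i) U"
proof
  assume "hless U (ultra_class U x) (ultra_class U y)"
  then obtain x' y' where "eventually (\<lambda>i. x i = x' i) U" "eventually (\<lambda>i. y i = y' i) U"
    "eventually (\<lambda>i. x' i < y' i) U" by (auto simp: hless_def mem_ultra_class)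
  then show "eventually (\<lambda>i. x i < y i) U" by eventually_elim simp
next
  assume "eventually (\<lambda>i. x i < y i) U"
  moreover have "x \<in> ultra_class U x" "y \<in> ultra_class U y" by (simp_all add: mem_ultra_class)
  ultimately show "hless U (ultra_class U x) (ultra_class U y)" unfolding hless_def by blast
qed

lemma is_dual_unique:
  assumes n: "n \<in> hints U" and p: "is_dual U \<theta> n p" and q: "is_dual U \<theta> n q"
  shows "p = q"
proof -
  obtain x y z where x: "n = ultra_class U x"
    and y: "p = ultra_class U y" "\<forall>i. y i \<in> \<int>" and z: "q = ultra_class U z" "\<forall>i. z i \<in> \<int>"
    using assms unfolding is_dual_def hints_def ultrapower_def by blast
  have "eventually (\<lambda>i. \<bar>x i * \<theta> - y i\<bar> < 1/2) U" "eventually (\<lambda>i. \<bar>x i * \<theta> - z i\<bar> < 1/2) U"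
    using p q unfolding is_dual_def hinfinitesimal_def x y z hmul_def hconst_def hsub_def habs_def
      hlift2_class hlift_class hless_class by (auto dest!: spec[of _ "1/2"] simp: hlift_class hless_class)
  then have "eventually (\<lambda>i. y i = z i) U"
  proof eventually_elim
    case (elim i)
    then have "\<bar>y i - z i\<bar> < 1" by linarith
    then show ?case using y(2) z(2) Ints_diff Ints_nonzero_abs_less1 eq_iff_diff_eq_0 by metis
  qed
  then show ?thesis by (simp add: y z ultra_class_eq_iff)
qed

end

theory Submission
  imports Defs
begin

text \<open>
  Write \<open>m\<theta> = p + e\<close> and \<open>n\<eta> = q + f\<close> with \<open>p, q\<close> the duals of \<open>m, n\<close>. The candidate duals of \<open>mn\<close> have
  errors \<open>mn\<theta>\<eta> - pq = m\<theta>f + n\<eta>e - ef\<close> and \<open>mn(\<theta> \<plusminus> \<eta>) - (pn \<plusminus> mq) = ne \<plusminus> mf\<close>. If \<open>x, y\<close> represent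
  \<open>\<mu>, \<nu>\<close> then \<open>e = O(y)\<close> and \<open>f = O(x)\<close>, so every term is \<open>O(|mx| + |ny|)\<close>; for \<open>ef\<close> this uses
  \<open>|m| \<ge> 1\<close> unless \<open>m = 0\<close>, and in that case \<open>e = 0\<close>. The hypothesis on the growth of \<open>m\<close> and \<open>n\<close> says
  exactly that \<open>mx\<close> and \<open>ny\<close> are infinitesimal, respectively smaller than \<open>\<iota>\<close> and \<open>\<kappa>\<close>.
\<close>

section \<open>Hyperreals and infinitesimals through representing sequences\<close>

lemma ex_ultra_class_hreals: "X \<in> hreals U \<Longrightarrow> \<exists>x. X = ultra_class U x"
  by (auto simp: hreals_def ultrapower_def)

lemma ultra_class_in_hreals [simp]: "ultra_class U x \<in> hreals U"
  by (auto simp: hreals_def ultrapower_def)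

lemma hop_class:
  "hmul U (ultra_class U x) (ultra_class U y) = ultra_class U (\<lambda>i. x i * y i)"
  "hadd U (ultra_class U x) (ultra_class U y) = ultra_class U (\<lambda>i. x i + y i)"
  "hsub U (ultra_class U x) (ultra_class U y) = ultra_class U (\<lambda>i. x i - y i)"
  "habs U (ultra_class U x) = ultra_class U (\<lambda>i. \<bar>x i\<bar>)"
  "hinv U (ultra_class U x) = ultra_class U (\<lambda>i. inverse (x i))"
  by (simp_all add: hmul_def hadd_def hsub_def habs_def hinv_def hlift_class hlift2_class)

lemma hinfinitesimal_class:
  "ultra_class U x \<in> hinfinitesimal U \<longleftrightarrow> (\<forall>r>0. eventually (\<lambda>i. \<bar>x i\<bar> < r) U)"
  by (simp add: hinfinitesimal_def hop_class hconst_def hless_class)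

text \<open>Infinitesimals absorb real factors: \<open>z\<close> falls below \<open>r\<close> in
  absolute value as soon as \<open>x\<close> falls below \<open>r / L\<close>, where
  \<open>L\<close> majorizes \<open>K\<close>.\<close>

lemma hinfinitesimal_bounded:
  assumes "ultra_class U x \<in> hinfinitesimal U" "eventually (\<lambda>i. \<bar>z i\<bar> \<le> K * \<bar>x i\<bar>) U"
  shows "ultra_class U z \<in> hinfinitesimal U"
  unfolding hinfinitesimal_class
proof (intro allI impI)
  fix r :: real assume r: "r > 0"
  \<comment> \<open>Adding 1 keeps \<open>L\<close> positive whatever the sign of \<open>K\<close>,
    so \<open>r / L\<close> is a legitimate threshold.\<close>
  define L where "L = \<bar>K\<bar> + 1"
  have L: "L > 0" "K \<le> L" by (auto simp: L_def)
  have "eventually (\<lambda>i. \<bar>x i\<bar> < r / L) U"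
    using assms(1) r L by (auto simp: hinfinitesimal_class)
  with assms(2) show "eventually (\<lambda>i. \<bar>z i\<bar> < r) U"
  proof eventually_elim
    case (elim i)
    have "K * \<bar>x i\<bar> \<le> L * \<bar>x i\<bar>" using L by (simp add: mult_right_mono)
    also have "\<dots> < r" using elim(2) L by (simp add: field_simps)
    finally show ?case using elim(1) by simp
  qed
qed

text \<open>Sums of absolute values serve both as error bounds and as representatives of a maximum
  of two classes.\<close>

lemma hinfinitesimal_abs_add:
  assumes "ultra_class U x \<in> hinfinitesimal U" "ultra_class U y \<in> hinfinitesimal U"
  shows "ultra_class U (\<lambda>i. \<bar>x i\<bar> + \<bar>y i\<bar>) \<in> hinfinitesimal U"
  unfolding hinfinitesimal_class
proof (intro allI impI)
  fix r :: real assume "r > 0"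
  then have "eventually (\<lambda>i. \<bar>x i\<bar> < r / 2) U" "eventually (\<lambda>i. \<bar>y i\<bar> < r / 2) U"
    using assms unfolding hinfinitesimal_class by (meson half_gt_zero)+
  then show "eventually (\<lambda>i. \<bar>\<bar>x i\<bar> + \<bar>y i\<bar>\<bar> < r) U" by eventually_elim auto
qed

lemma ex_ultra_class_pp_class: "Y \<in> pp_class U X \<Longrightarrow> \<exists>y. Y = ultra_class U y"
  by (auto simp: pp_class_def pp_rel_def hnonneg_def hconst_def dest: ex_ultra_class_hreals)

lemma dual_eq: "n \<in> hints U \<Longrightarrow> is_dual U \<theta> n p \<Longrightarrow> dual U \<theta> n = p"
  unfolding dual_def by (metis is_dual_unique the_equality)

section \<open>The semiring of growth-decay classes: membership, equality and order in terms of
  representatives\<close>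

locale nonprincipal_ultra =
  fixes U :: "nat filter"
  assumes ultra: "nonprincipal_ultrafilter U"
begin

text \<open>The dichotomy of an ultrafilter; totality of the order on classes rests on it.\<close>

lemma eventually_not: "\<not> eventually P U \<Longrightarrow> eventually (\<lambda>i. \<not> P i) U"
  using ultra by (auto simp: nonprincipal_ultrafilter_def)

lemma not_eventually_False: "\<not> eventually (\<lambda>i. False) U"
  using ultra by (auto simp: nonprincipal_ultrafilter_def eventually_False)

lemma hnonneg_class: "ultra_class U x \<in> hnonneg U \<longleftrightarrow> eventually (\<lambda>i. 0 \<le> x i) U"
proof
  assume "ultra_class U x \<in> hnonneg U"
  then have "eventually (\<lambda>i. 0 < x i) U \<or> eventually (\<lambda>i. x i = 0) U"
    by (auto simp: hnonneg_def hconst_def hless_class ultra_class_eq_iff)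
  then show "eventually (\<lambda>i. 0 \<le> x i) U" by (auto elim: eventually_mono)
next
  assume e: "eventually (\<lambda>i. 0 \<le> x i) U"
  show "ultra_class U x \<in> hnonneg U"
  proof (cases "eventually (\<lambda>i. 0 < x i) U")
    case True
    then show ?thesis by (simp add: hnonneg_def hconst_def hless_class)
  next
    case False
    from eventually_not[OF this] e have "eventually (\<lambda>i. x i = 0) U" by eventually_elim auto
    then show ?thesis by (simp add: hnonneg_def hconst_def ultra_class_eq_iff)
  qed
qed

text \<open>Positive, finite and not infinitesimal together mean being squeezed between
  \<open>1 / c\<close> and \<open>c\<close> for a real \<open>c\<close>. The lower bound is kept
  free of division.\<close>

lemma hfin_units_pos_class:
  "ultra_class U u \<in> hfin_units_pos U \<longleftrightarrow> (\<exists>c>0. eventually (\<lambda>i. 1 \<le> c * u i \<and> u i \<le> c) U)"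
proof
  assume "ultra_class U u \<in> hfin_units_pos U"
  then obtain r s where r: "eventually (\<lambda>i. \<bar>u i\<bar> < r) U" and p: "eventually (\<lambda>i. 0 < u i) U"
    and s: "s > 0" "\<not> eventually (\<lambda>i. \<bar>u i\<bar> < s) U"
    by (auto simp: hfin_units_pos_def hfin_def hinfinitesimal_class hop_class hconst_def hless_class)
  \<comment> \<open>\<open>r\<close> bounds \<open>u\<close> from above, while by the dichotomy
    \<open>u\<close> stays at or above \<open>s\<close>, so \<open>1 / s\<close> handles the lower
    bound. The maximum is one constant for both.\<close>
  define c where "c = max (\<bar>r\<bar>) (1 / s)"
  have c: "r \<le> c" "1 / s \<le> c" "c > 0" using s by (auto simp: c_def less_max_iff_disj)
  have "eventually (\<lambda>i. 1 \<le> c * u i \<and> u i \<le> c) U"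
    using eventually_not[OF s(2)] r p
  proof eventually_elim
    case (elim i)
    then have "s \<le> u i" by simp
    then have "1 \<le> (1 / s) * u i" using s by (simp add: field_simps)
    also have "\<dots> \<le> c * u i" using c elim by (intro mult_right_mono) auto
    finally show ?case using elim c by auto
  qed
  then show "\<exists>c>0. eventually (\<lambda>i. 1 \<le> c * u i \<and> u i \<le> c) U" using c by blast
next
  assume "\<exists>c>0. eventually (\<lambda>i. 1 \<le> c * u i \<and> u i \<le> c) U"
  then obtain c where c: "c > 0" "eventually (\<lambda>i. 1 \<le> c * u i \<and> u i \<le> c) U" by blast
  have p: "eventually (\<lambda>i. 1 / c \<le> u i \<and> 0 < u i \<and> \<bar>u i\<bar> < c + 1) U"
    using c(2)
  proof eventually_elim
    case (elim i)
    have "1 / c \<le> u i" using elim c(1) by (simp add: field_simps)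
    moreover have "0 < 1 / c" using c(1) by simp
    ultimately have "0 < u i" by linarith
    with \<open>1 / c \<le> u i\<close> elim show ?case by auto
  qed
  \<comment> \<open>The real \<open>1 / c\<close> witnesses that \<open>u\<close> is not
    infinitesimal; the contradiction comes from properness of \<open>U\<close>.\<close>
  have "\<not> eventually (\<lambda>i. \<bar>u i\<bar> < 1 / c) U"
  proof
    assume "eventually (\<lambda>i. \<bar>u i\<bar> < 1 / c) U"
    with p have "eventually (\<lambda>i. False) U" by eventually_elim auto
    then show False using not_eventually_False by blast
  qed
  moreover have "eventually (\<lambda>i. 0 < u i) U" "eventually (\<lambda>i. \<bar>u i\<bar> < c + 1) U"
    using p by (auto elim: eventually_mono)
  moreover have "1 / c > 0" using c(1) by simp
  ultimately show "ultra_class U u \<in> hfin_units_pos U"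
    unfolding hfin_units_pos_def hfin_def mem_Collect_eq hinfinitesimal_class hop_class hconst_def
      hless_class
    by (blast intro: ultra_class_in_hreals)
qed

text \<open>A unit factor between two sequences amounts to comparability up to a real constant. No
  absolute value is put on \<open>y\<close>, because the two inequalities force it to be
  nonnegative.\<close>

lemma mem_pp_class:
  "ultra_class U y \<in> pp_class U (ultra_class U x) \<longleftrightarrow>
     (\<exists>c>0. eventually (\<lambda>i. \<bar>x i\<bar> \<le> c * y i \<and> y i \<le> c * \<bar>x i\<bar>) U)"
proof
  assume "ultra_class U y \<in> pp_class U (ultra_class U x)"
  then obtain u where "u \<in> hfin_units_pos U"
    and "ultra_class U y = hmul U u (ultra_class U (\<lambda>i. \<bar>x i\<bar>))"
    by (auto simp: pp_class_def pp_rel_def hop_class)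
  moreover obtain v where "u = ultra_class U v"
    using \<open>u \<in> hfin_units_pos U\<close> ex_ultra_class_hreals
    by (auto simp: hfin_units_pos_def hfin_def)
  ultimately obtain c where c: "c > 0" "eventually (\<lambda>i. 1 \<le> c * v i \<and> v i \<le> c) U"
    and e: "eventually (\<lambda>i. y i = v i * \<bar>x i\<bar>) U"
    by (auto simp: hfin_units_pos_class hop_class ultra_class_eq_iff)
  have "eventually (\<lambda>i. \<bar>x i\<bar> \<le> c * y i \<and> y i \<le> c * \<bar>x i\<bar>) U"
    using c(2) e
  proof eventually_elim
    case (elim i)
    then show ?case using mult_right_mono[of 1 "c * v i" "\<bar>x i\<bar>"] mult_right_mono[of "v i" c "\<bar>x i\<bar>"]
      by (simp add: mult.assoc)
  qed
  then show "\<exists>c>0. eventually (\<lambda>i. \<bar>x i\<bar> \<le> c * y i \<and> y i \<le> c * \<bar>x i\<bar>) U" using c by blast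
next
  assume "\<exists>c>0. eventually (\<lambda>i. \<bar>x i\<bar> \<le> c * y i \<and> y i \<le> c * \<bar>x i\<bar>) U"
  then obtain c where c: "c > 0" "eventually (\<lambda>i. \<bar>x i\<bar> \<le> c * y i \<and> y i \<le> c * \<bar>x i\<bar>) U" by blast
  \<comment> \<open>The unit is the quotient. Where \<open>x i\<close> vanishes the inequalities
    make \<open>y i\<close> vanish too, so any value works; the choice 1 is why the constant below
    is \<open>max c 1\<close>.\<close>
  define v where "v i = (if x i = 0 then 1 else y i / \<bar>x i\<bar>)" for i
  have n: "eventually (\<lambda>i. 0 \<le> y i) U"
    using c(2)
  proof eventually_elim
    case (elim i)
    then have "0 \<le> c * y i" by linarith
    then show ?case using c(1) by (simp add: zero_le_mult_iff)
  qed
  have "eventually (\<lambda>i. y i = v i * \<bar>x i\<bar>) U"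
    using c(2) n by eventually_elim (auto simp: v_def)
  moreover have "eventually (\<lambda>i. 1 \<le> max c 1 * v i \<and> v i \<le> max c 1) U"
    using c(2) n
  proof eventually_elim
    case (elim i)
    show ?case
    proof (cases "x i = 0")
      case False
      then have p: "\<bar>x i\<bar> > 0" by simp
      have "1 \<le> c * v i" "v i \<le> c" "0 \<le> v i"
        using elim p False by (auto simp: v_def divide_le_eq le_divide_eq)
      moreover have "c * v i \<le> max c 1 * v i" using \<open>0 \<le> v i\<close> by (intro mult_right_mono) auto
      ultimately show ?thesis by auto
    qed (simp add: v_def)
  qed
  then have "ultra_class U v \<in> hfin_units_pos U"
    unfolding hfin_units_pos_class by (intro exI[of _ "max c 1"]) auto
  ultimately have "\<exists>u\<in>hfin_units_pos U. ultra_class U y = hmul U u (ultra_class U (\<lambda>i. \<bar>x i\<bar>))"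
    by (intro bexI[of _ "ultra_class U v"]) (simp_all add: hop_class ultra_class_eq_iff)
  then show "ultra_class U y \<in> pp_class U (ultra_class U x)"
    using n by (simp add: pp_class_def pp_rel_def hop_class hnonneg_class)
qed

lemma ultra_class_abs_in_pp_class: "ultra_class U (\<lambda>i. \<bar>x i\<bar>) \<in> pp_class U (ultra_class U x)"
  unfolding mem_pp_class by (intro exI[of _ 1]) simp

lemma pp_class_eq_iff:
  "pp_class U (ultra_class U x) = pp_class U (ultra_class U y) \<longleftrightarrow>
     (\<exists>c>0. eventually (\<lambda>i. \<bar>x i\<bar> \<le> c * \<bar>y i\<bar> \<and> \<bar>y i\<bar> \<le> c * \<bar>x i\<bar>) U)"
proof
  assume e: "pp_class U (ultra_class U x) = pp_class U (ultra_class U y)"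
  show "\<exists>c>0. eventually (\<lambda>i. \<bar>x i\<bar> \<le> c * \<bar>y i\<bar> \<and> \<bar>y i\<bar> \<le> c * \<bar>x i\<bar>) U"
    using ultra_class_abs_in_pp_class[of y] unfolding e[symmetric] mem_pp_class .
next
  \<comment> \<open>The condition is symmetric in \<open>x\<close> and \<open>y\<close>, so one
    inclusion suffices. The constants of the two comparisons multiply.\<close>
  have sub: "pp_class U (ultra_class U x) \<subseteq> pp_class U (ultra_class U y)"
    if c: "c > 0" "eventually (\<lambda>i. \<bar>x i\<bar> \<le> c * \<bar>y i\<bar> \<and> \<bar>y i\<bar> \<le> c * \<bar>x i\<bar>) U" for x y and c :: real
  proof
    fix Z assume Z: "Z \<in> pp_class U (ultra_class U x)"
    then obtain z where z: "Z = ultra_class U z" using ex_ultra_class_pp_class by blast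
    with Z obtain d where d: "d > 0" "eventually (\<lambda>i. \<bar>x i\<bar> \<le> d * z i \<and> z i \<le> d * \<bar>x i\<bar>) U"
      by (auto simp: mem_pp_class)
    have "eventually (\<lambda>i. \<bar>y i\<bar> \<le> (c * d) * z i \<and> z i \<le> (c * d) * \<bar>y i\<bar>) U"
      using c(2) d(2)
    proof eventually_elim
      case (elim i)
      have "c * \<bar>x i\<bar> \<le> c * (d * z i)" "d * \<bar>x i\<bar> \<le> d * (c * \<bar>y i\<bar>)"
        using elim c(1) d(1) by simp_all
      with elim show ?case by (simp add: ac_simps)
    qed
    then show "Z \<in> pp_class U (ultra_class U y)" unfolding z mem_pp_class
      using c(1) d(1) by (intro exI[of _ "c * d"]) auto
  qed
  assume "\<exists>c>0. eventually (\<lambda>i. \<bar>x i\<bar> \<le> c * \<bar>y i\<bar> \<and> \<bar>y i\<bar> \<le> c * \<bar>x i\<bar>) U"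
  then obtain c where c: "c > 0" "eventually (\<lambda>i. \<bar>x i\<bar> \<le> c * \<bar>y i\<bar> \<and> \<bar>y i\<bar> \<le> c * \<bar>x i\<bar>) U" by blast
  then have "eventually (\<lambda>i. \<bar>y i\<bar> \<le> c * \<bar>x i\<bar> \<and> \<bar>x i\<bar> \<le> c * \<bar>y i\<bar>) U" by (auto elim: eventually_mono)
  with c show "pp_class U (ultra_class U x) = pp_class U (ultra_class U y)"
    by (intro equalityI sub)
qed

lemma pp_class_eqI:
  assumes "eventually (\<lambda>i. \<bar>x i\<bar> \<le> c * \<bar>y i\<bar>) U" "eventually (\<lambda>i. \<bar>y i\<bar> \<le> d * \<bar>x i\<bar>) U"
  shows "pp_class U (ultra_class U x) = pp_class U (ultra_class U y)"
  unfolding pp_class_eq_iff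
proof (intro exI conjI)
  \<comment> \<open>A positive constant dominating both \<open>c\<close> and \<open>d\<close>, whose
    signs are unknown.\<close>
  let ?k = "\<bar>c\<bar> + \<bar>d\<bar> + 1"
  show "?k > 0" by simp
  show "eventually (\<lambda>i. \<bar>x i\<bar> \<le> ?k * \<bar>y i\<bar> \<and> \<bar>y i\<bar> \<le> ?k * \<bar>x i\<bar>) U"
    using assms
  proof eventually_elim
    case (elim i)
    have "c * \<bar>y i\<bar> \<le> ?k * \<bar>y i\<bar>" "d * \<bar>x i\<bar> \<le> ?k * \<bar>x i\<bar>" by (intro mult_right_mono; simp)+
    with elim show ?case by linarith
  qed
qed

text \<open>The strict order quantifies over all representatives, and these include every positive
  real multiple of a given one. So it says that \<open>x\<close> is little-o of
  \<open>y\<close>.\<close>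

lemma pp_less_class:
  "pp_less U (pp_class U (ultra_class U x)) (pp_class U (ultra_class U y)) \<longleftrightarrow>
     (\<forall>c>0. eventually (\<lambda>i. c * \<bar>x i\<bar> < \<bar>y i\<bar>) U)"
proof (intro iffI allI impI)
  fix c :: real
  assume l: "pp_less U (pp_class U (ultra_class U x)) (pp_class U (ultra_class U y))" and c: "c > 0"
  \<comment> \<open>Scaling by \<open>c\<close> stays within the class, with comparability constant
    \<open>max c (1 / c)\<close>.\<close>
  have "\<bar>x i\<bar> \<le> max c (1 / c) * (c * \<bar>x i\<bar>) \<and> c * \<bar>x i\<bar> \<le> max c (1 / c) * \<bar>x i\<bar>" for i
  proof
    have "(1 / c) * (c * \<bar>x i\<bar>) \<le> max c (1 / c) * (c * \<bar>x i\<bar>)"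
      using c by (intro mult_right_mono) auto
    then show "\<bar>x i\<bar> \<le> max c (1 / c) * (c * \<bar>x i\<bar>)" using c by simp
  qed (intro mult_right_mono; simp)
  then have "ultra_class U (\<lambda>i. c * \<bar>x i\<bar>) \<in> pp_class U (ultra_class U x)"
    unfolding mem_pp_class using c by (intro exI[of _ "max c (1 / c)"]) (simp add: less_max_iff_disj)
  then show "eventually (\<lambda>i. c * \<bar>x i\<bar> < \<bar>y i\<bar>) U"
    using l ultra_class_abs_in_pp_class[of y] unfolding pp_less_def hless_class[symmetric] by blast
next
  assume l: "\<forall>c>0. eventually (\<lambda>i. c * \<bar>x i\<bar> < \<bar>y i\<bar>) U"
  show "pp_less U (pp_class U (ultra_class U x)) (pp_class U (ultra_class U y))"
    unfolding pp_less_def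
  proof (intro ballI)
    fix X Y assume XY: "X \<in> pp_class U (ultra_class U x)" "Y \<in> pp_class U (ultra_class U y)"
    then obtain v w where vw: "X = ultra_class U v" "Y = ultra_class U w"
      using ex_ultra_class_pp_class by blast
    from XY obtain c d where
      c: "c > 0" "eventually (\<lambda>i. \<bar>x i\<bar> \<le> c * v i \<and> v i \<le> c * \<bar>x i\<bar>) U" and
      d: "d > 0" "eventually (\<lambda>i. \<bar>y i\<bar> \<le> d * w i \<and> w i \<le> d * \<bar>y i\<bar>) U"
      unfolding vw mem_pp_class by blast
    \<comment> \<open>The factor \<open>d * c\<close> pays for passing from \<open>v\<close> to
      \<open>x\<close> and from \<open>y\<close> to \<open>w\<close>.\<close>
    have "eventually (\<lambda>i. (d * c) * \<bar>x i\<bar> < \<bar>y i\<bar>) U" using l c(1) d(1) by simp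
    with c(2) d(2) have "eventually (\<lambda>i. v i < w i) U"
    proof eventually_elim
      case (elim i)
      have "d * v i \<le> d * (c * \<bar>x i\<bar>)" using elim d(1) by simp
      also have "\<dots> < d * w i" using elim by (simp add: mult.assoc)
      finally show ?case using d(1) by simp
    qed
    then show "hless U X Y" by (simp add: vw hless_class)
  qed
qed

text \<open>If the class of \<open>x\<close> is not strictly smaller, the dichotomy gives some
  \<open>d\<close> with \<open>y\<close> at most \<open>d\<close> times \<open>x\<close>. With the
  assumed bound this is comparability, hence equality of classes.\<close>

lemma pp_le_class:
  "pp_le U (pp_class U (ultra_class U x)) (pp_class U (ultra_class U y)) \<longleftrightarrow>
     (\<exists>c. eventually (\<lambda>i. \<bar>x i\<bar> \<le> c * \<bar>y i\<bar>) U)"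
proof
  assume "pp_le U (pp_class U (ultra_class U x)) (pp_class U (ultra_class U y))"
  then consider "\<forall>c>0. eventually (\<lambda>i. c * \<bar>x i\<bar> < \<bar>y i\<bar>) U"
    | c where "c > 0" "eventually (\<lambda>i. \<bar>x i\<bar> \<le> c * \<bar>y i\<bar> \<and> \<bar>y i\<bar> \<le> c * \<bar>x i\<bar>) U"
    unfolding pp_le_def pp_less_class pp_class_eq_iff by blast
  then show "\<exists>c. eventually (\<lambda>i. \<bar>x i\<bar> \<le> c * \<bar>y i\<bar>) U"
  proof cases
    case 1
    then have "eventually (\<lambda>i. 1 * \<bar>x i\<bar> < \<bar>y i\<bar>) U" by (meson zero_less_one)
    then show ?thesis by (intro exI[of _ 1]) (auto elim: eventually_mono)
  qed (auto elim: eventually_mono)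
next
  assume "\<exists>c. eventually (\<lambda>i. \<bar>x i\<bar> \<le> c * \<bar>y i\<bar>) U"
  then obtain c where c: "eventually (\<lambda>i. \<bar>x i\<bar> \<le> c * \<bar>y i\<bar>) U" by blast
  show "pp_le U (pp_class U (ultra_class U x)) (pp_class U (ultra_class U y))"
  proof (cases "pp_less U (pp_class U (ultra_class U x)) (pp_class U (ultra_class U y))")
    case False
    then obtain d where "\<not> eventually (\<lambda>i. d * \<bar>x i\<bar> < \<bar>y i\<bar>) U"
      unfolding pp_less_class by blast
    then have "eventually (\<lambda>i. \<bar>y i\<bar> \<le> d * \<bar>x i\<bar>) U"
      using eventually_not by (fastforce simp: not_less)
    from pp_class_eqI[OF c this] show ?thesis by (simp add: pp_le_def)
  qed (simp add: pp_le_def)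
qed

section \<open>Product, inverse and sum of classes on representatives\<close>

lemma pp_mul_class:
  "pp_mul U (pp_class U (ultra_class U x)) (pp_class U (ultra_class U y)) =
     pp_class U (ultra_class U (\<lambda>i. x i * y i))"
proof -
  \<comment> \<open>The union defining \<open>pp_mul\<close> collapses because every pair of
    representatives contributes the same class.\<close>
  have "pp_class U (hmul U X Y) = pp_class U (ultra_class U (\<lambda>i. x i * y i))"
    if XY: "X \<in> pp_class U (ultra_class U x)" "Y \<in> pp_class U (ultra_class U y)" for X Y
  proof -
    obtain v w where vw: "X = ultra_class U v" "Y = ultra_class U w"
      using XY ex_ultra_class_pp_class by blast
    from XY obtain c d where
      c: "c > 0" "eventually (\<lambda>i. \<bar>x i\<bar> \<le> c * v i \<and> v i \<le> c * \<bar>x i\<bar>) U" and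
      d: "d > 0" "eventually (\<lambda>i. \<bar>y i\<bar> \<le> d * w i \<and> w i \<le> d * \<bar>y i\<bar>) U"
      unfolding vw mem_pp_class by blast
    have "eventually (\<lambda>i. \<bar>v i * w i\<bar> \<le> (c * d) * \<bar>x i * y i\<bar> \<and>
        \<bar>x i * y i\<bar> \<le> (c * d) * \<bar>v i * w i\<bar>) U"
      using c(2) d(2)
    proof eventually_elim
      case (elim i)
      have "0 \<le> c * v i" "0 \<le> d * w i" using elim by linarith+
      then have p: "0 \<le> v i" "0 \<le> w i" using c(1) d(1) by (simp_all add: zero_le_mult_iff)
      have "v i * w i \<le> (c * \<bar>x i\<bar>) * (d * \<bar>y i\<bar>)" "\<bar>x i\<bar> * \<bar>y i\<bar> \<le> (c * v i) * (d * w i)"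
        using elim p c(1) d(1) by (auto intro!: mult_mono)
      then show ?case using p by (simp add: abs_mult ac_simps)
    qed
    then show ?thesis unfolding vw hop_class pp_class_eq_iff
      using c(1) d(1) by (intro exI[of _ "c * d"]) simp
  qed
  then show ?thesis unfolding pp_mul_def
    using ultra_class_abs_in_pp_class by blast
qed

lemma pp_inv_class:
  "pp_inv U (pp_class U (ultra_class U x)) = pp_class U (ultra_class U (\<lambda>i. inverse (x i)))"
proof -
  have "pp_class U (hinv U X) = pp_class U (ultra_class U (\<lambda>i. inverse (x i)))"
    if X: "X \<in> pp_class U (ultra_class U x)" for X
  proof -
    obtain v where v: "X = ultra_class U v"
      using X ex_ultra_class_pp_class by blast
    from X obtain c where
      c: "c > 0" "eventually (\<lambda>i. \<bar>x i\<bar> \<le> c * v i \<and> v i \<le> c * \<bar>x i\<bar>) U"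
      unfolding v mem_pp_class by blast
    have "eventually (\<lambda>i. \<bar>inverse (v i)\<bar> \<le> c * \<bar>inverse (x i)\<bar> \<and>
        \<bar>inverse (x i)\<bar> \<le> c * \<bar>inverse (v i)\<bar>) U"
      using c(2)
    proof eventually_elim
      case (elim i)
      have "0 \<le> c * v i" using elim by linarith
      then have p: "0 \<le> v i" using c(1) by (simp add: zero_le_mult_iff)
      show ?case
      proof (cases "x i = 0")
        \<comment> \<open>Here \<open>v i\<close> vanishes as well, and both inverses take the
          default value 0.\<close>
        case True
        with elim p show ?thesis by auto
      next
        case False
        with elim p have "0 < v i" by (cases "v i = 0") auto
        with False elim c(1) show ?thesis by (simp add: field_simps)
      qed
    qed
    then show ?thesis unfolding v hop_class pp_class_eq_iff
      using c(1) by (intro exI[of _ c]) simp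
  qed
  then show ?thesis unfolding pp_inv_def
    using ultra_class_abs_in_pp_class by blast
qed

text \<open>The maximum of two nonnegative quantities and their sum are comparable. The sum is the
  form in which error bounds arise.\<close>

lemma pp_add_class:
  "pp_add U (pp_class U (ultra_class U x)) (pp_class U (ultra_class U y)) =
     pp_class U (ultra_class U (\<lambda>i. \<bar>x i\<bar> + \<bar>y i\<bar>))"
proof (cases "pp_le U (pp_class U (ultra_class U x)) (pp_class U (ultra_class U y))")
  case True
  then obtain c where c: "eventually (\<lambda>i. \<bar>x i\<bar> \<le> c * \<bar>y i\<bar>) U" by (auto simp: pp_le_class)
  have "eventually (\<lambda>i. \<bar>y i\<bar> \<le> 1 * \<bar>\<bar>x i\<bar> + \<bar>y i\<bar>\<bar>) U" by simp
  moreover from c have "eventually (\<lambda>i. \<bar>\<bar>x i\<bar> + \<bar>y i\<bar>\<bar> \<le> (c + 1) * \<bar>y i\<bar>) U"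
    by eventually_elim (simp add: algebra_simps)
  ultimately show ?thesis using True unfolding pp_add_def by (simp only: if_True) (rule pp_class_eqI)
next
  case False
  then have "\<not> eventually (\<lambda>i. \<bar>x i\<bar> \<le> 1 * \<bar>y i\<bar>) U" unfolding pp_le_class by blast
  from eventually_not[OF this]
  have "eventually (\<lambda>i. \<bar>\<bar>x i\<bar> + \<bar>y i\<bar>\<bar> \<le> 2 * \<bar>x i\<bar>) U" by eventually_elim auto
  moreover have "eventually (\<lambda>i. \<bar>x i\<bar> \<le> 1 * \<bar>\<bar>x i\<bar> + \<bar>y i\<bar>\<bar>) U" by simp
  ultimately show ?thesis using False unfolding pp_add_def
    by (simp only: if_False) (rule pp_class_eqI)
qed

section \<open>Growth and decay filtrations in terms of representatives\<close>

lemma hints_growth_class: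
  "ultra_class U a \<in> hints_growth U (pp_class U (ultra_class U x)) \<longleftrightarrow>
     ultra_class U a \<in> hints U \<and> ultra_class U (\<lambda>i. a i * x i) \<in> hinfinitesimal U"
proof (cases "eventually (\<lambda>i. a i = 0) U")
  \<comment> \<open>The definition admits 0 separately, but 0 times \<open>x\<close> is
    infinitesimal, so the criterion covers it.\<close>
  case True
  then have "eventually (\<lambda>i. \<bar>a i * x i\<bar> < r) U" if "r > 0" for r
    using that by (auto elim: eventually_mono)
  with True show ?thesis
    by (auto simp: hints_growth_def hconst_def ultra_class_eq_iff hinfinitesimal_class)
next
  case False
  from eventually_not[OF this] have nz: "eventually (\<lambda>i. a i \<noteq> 0) U" .
  \<comment> \<open>Multiplying through by \<open>\<bar>a i\<bar>\<close> moves \<open>a\<close> to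
    the other side. As \<open>c\<close> runs through the positive reals, so does
    \<open>1 / c\<close>.\<close>
  have iff: "eventually (\<lambda>i. c * \<bar>x i\<bar> < \<bar>inverse (a i)\<bar>) U \<longleftrightarrow>
      eventually (\<lambda>i. \<bar>a i * x i\<bar> < 1 / c) U" if "c > 0" for c
    by (rule eventually_subst, use nz in eventually_elim)
      (use that in \<open>simp add: abs_mult field_simps\<close>)
  have "(\<forall>c>0. eventually (\<lambda>i. c * \<bar>x i\<bar> < \<bar>inverse (a i)\<bar>) U) \<longleftrightarrow>
      (\<forall>r>0. eventually (\<lambda>i. \<bar>a i * x i\<bar> < r) U)"
  proof (intro iffI allI impI)
    fix r :: real
    assume l: "\<forall>c>0. eventually (\<lambda>i. c * \<bar>x i\<bar> < \<bar>inverse (a i)\<bar>) U" and "r > 0"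
    then have "1 / r > 0" by simp
    with l iff[of "1 / r"] have "eventually (\<lambda>i. \<bar>a i * x i\<bar> < 1 / (1 / r)) U" by blast
    then show "eventually (\<lambda>i. \<bar>a i * x i\<bar> < r) U" by simp
  next
    fix c :: real
    assume "\<forall>r>0. eventually (\<lambda>i. \<bar>a i * x i\<bar> < r) U" "c > 0"
    then show "eventually (\<lambda>i. c * \<bar>x i\<bar> < \<bar>inverse (a i)\<bar>) U" using iff[of c] by simp
  qed
  with False show ?thesis
    by (simp add: hints_growth_def hconst_def ultra_class_eq_iff pp_inv_class pp_less_class
        hinfinitesimal_class)
qed

lemma hints_fine_class:
  "ultra_class U a \<in> hints_fine U (pp_class U (ultra_class U x)) (pp_class U (ultra_class U t)) \<longleftrightarrow>
     ultra_class U a \<in> hints U \<and> (\<forall>c>0. eventually (\<lambda>i. c * \<bar>a i * x i\<bar> < \<bar>t i\<bar>) U)"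
  by (simp add: hints_fine_def pp_mul_class pp_less_class)

text \<open>By uniqueness any exhibited dual is the value of \<open>dual\<close>, so its error
  decides the decay.\<close>

lemma dioph_decayI:
  assumes "ultra_class U a \<in> hints U" "is_dual U \<theta> (ultra_class U a) (ultra_class U p)"
    and "eventually (\<lambda>i. \<bar>a i * \<theta> - p i\<bar> \<le> K * \<bar>x i\<bar>) U"
  shows "ultra_class U a \<in> dioph_decay U (pp_class U (ultra_class U x)) \<theta>"
  using assms dual_eq[OF assms(1,2)]
  by (auto simp: dioph_decay_def dioph_def dual_error_def hop_class hconst_def pp_le_class)

text \<open>The representatives are integral at every index, which later allows pointwise integer
  arguments.\<close>

lemma dioph_decayE:
  assumes "m \<in> dioph_decay U (pp_class U (ultra_class U x)) \<theta>"
  obtains a p K where "m = ultra_class U a" "\<And>i. a i \<in> \<int>" "\<And>i. p i \<in> \<int>"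
    "is_dual U \<theta> m (ultra_class U p)"
    "eventually (\<lambda>i. \<bar>a i * \<theta> - p i\<bar> \<le> K * \<bar>x i\<bar>) U"
proof -
  from assms obtain P where m: "m \<in> hints U" and d: "is_dual U \<theta> m P"
    by (auto simp: dioph_decay_def dioph_def)
  obtain a p where a: "m = ultra_class U a" "\<And>i. a i \<in> \<int>" and p: "P = ultra_class U p" "\<And>i. p i \<in> \<int>"
    using m d by (auto simp: is_dual_def hints_def ultrapower_def)
  obtain K where "eventually (\<lambda>i. \<bar>a i * \<theta> - p i\<bar> \<le> K * \<bar>x i\<bar>) U"
    using assms dual_eq[OF m d]
    by (auto simp: dioph_decay_def dual_error_def a p hop_class hconst_def pp_le_class)
  with a p d show thesis by (intro that) auto
qed

section \<open>Error estimates for products of approximations\<close>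

text \<open>The estimates are stated with one bound \<open>|mx| + |ny|\<close> so that they serve both filtrations.\<close>

lemma product_errors:
  assumes m: "m \<in> dioph_decay U (pp_class U (ultra_class U y)) \<theta>"
    and n: "n \<in> dioph_decay U (pp_class U (ultra_class U x)) \<eta>"
  obtains a b p q K where "m = ultra_class U a" "n = ultra_class U b"
    "dual U \<theta> m = ultra_class U p" "dual U \<eta> n = ultra_class U q"
    "\<And>i. a i \<in> \<int>" "\<And>i. b i \<in> \<int>" "\<And>i. p i \<in> \<int>" "\<And>i. q i \<in> \<int>"
    "eventually (\<lambda>i. \<bar>a i * b i * (\<theta> * \<eta>) - p i * q i\<bar> \<le> K * \<bar>\<bar>a i * x i\<bar> + \<bar>b i * y i\<bar>\<bar>) U"
    "eventually (\<lambda>i. \<bar>a i * b i * (\<theta> + \<eta>) - (p i * b i + a i * q i)\<bar>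
        \<le> K * \<bar>\<bar>a i * x i\<bar> + \<bar>b i * y i\<bar>\<bar>) U"
    "eventually (\<lambda>i. \<bar>a i * b i * (\<theta> - \<eta>) - (p i * b i - a i * q i)\<bar>
        \<le> K * \<bar>\<bar>a i * x i\<bar> + \<bar>b i * y i\<bar>\<bar>) U"
proof -
  obtain a p C where a: "m = ultra_class U a" "\<And>i. a i \<in> \<int>" "\<And>i. p i \<in> \<int>"
    "is_dual U \<theta> m (ultra_class U p)" and C: "eventually (\<lambda>i. \<bar>a i * \<theta> - p i\<bar> \<le> C * \<bar>y i\<bar>) U"
    by (rule dioph_decayE[OF m]) (rule that)
  obtain b q D where b: "n = ultra_class U b" "\<And>i. b i \<in> \<int>" "\<And>i. q i \<in> \<int>"
    "is_dual U \<eta> n (ultra_class U q)" and D: "eventually (\<lambda>i. \<bar>b i * \<eta> - q i\<bar> \<le> D * \<bar>x i\<bar>) U"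
    by (rule dioph_decayE[OF n]) (rule that)
  \<comment> \<open>\<open>B\<close> serves both decay bounds. The coefficients in \<open>K\<close>
    belong to the three terms \<open>m\<theta>f\<close>, \<open>n\<eta>e\<close> and
    \<open>ef\<close>.\<close>
  define B where "B = \<bar>C\<bar> + \<bar>D\<bar>"
  define K where "K = B * (\<bar>\<theta>\<bar> + \<bar>\<eta>\<bar> + 1)"
  have B: "B \<ge> 0" "C \<le> B" "D \<le> B" by (auto simp: B_def)
  \<comment> \<open>The real bound 1 on the infinitesimal error \<open>e\<close> is all that the
    term \<open>ef\<close> requires.\<close>
  have small: "eventually (\<lambda>i. \<bar>a i * \<theta> - p i\<bar> < 1) U"
    using a(4) by (auto simp: is_dual_def a(1) hop_class hconst_def hinfinitesimal_class)
  have ev: "eventually (\<lambda>i.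
      \<bar>a i * b i * (\<theta> * \<eta>) - p i * q i\<bar> \<le> K * \<bar>\<bar>a i * x i\<bar> + \<bar>b i * y i\<bar>\<bar> \<and>
      \<bar>a i * b i * (\<theta> + \<eta>) - (p i * b i + a i * q i)\<bar> \<le> K * \<bar>\<bar>a i * x i\<bar> + \<bar>b i * y i\<bar>\<bar> \<and>
      \<bar>a i * b i * (\<theta> - \<eta>) - (p i * b i - a i * q i)\<bar> \<le> K * \<bar>\<bar>a i * x i\<bar> + \<bar>b i * y i\<bar>\<bar>) U"
    using C D small
  proof eventually_elim
    case (elim i)
    define e f where "e = a i * \<theta> - p i" and "f = b i * \<eta> - q i"
    define s where "s = \<bar>a i * x i\<bar> + \<bar>b i * y i\<bar>"
    have "C * \<bar>y i\<bar> \<le> B * \<bar>y i\<bar>" "D * \<bar>x i\<bar> \<le> B * \<bar>x i\<bar>"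
      using B by (auto intro: mult_right_mono)
    then have e: "\<bar>e\<bar> \<le> B * \<bar>y i\<bar>" "\<bar>e\<bar> \<le> 1" and f: "\<bar>f\<bar> \<le> B * \<bar>x i\<bar>"
      using elim by (auto simp: e_def f_def)
    have be: "\<bar>b i\<bar> * \<bar>e\<bar> \<le> B * \<bar>b i * y i\<bar>"
      using mult_left_mono[OF e(1), of "\<bar>b i\<bar>"] by (simp add: abs_mult ac_simps)
    have af: "\<bar>a i\<bar> * \<bar>f\<bar> \<le> B * \<bar>a i * x i\<bar>"
      using mult_left_mono[OF f, of "\<bar>a i\<bar>"] by (simp add: abs_mult ac_simps)
    have ef: "\<bar>e\<bar> * \<bar>f\<bar> \<le> B * \<bar>a i * x i\<bar>"
    proof (cases "a i = 0")
      case True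
      \<comment> \<open>With \<open>a i = 0\<close> the bound on \<open>e\<close> reads
        \<open>\<bar>p i\<bar> < 1\<close>, and \<open>p i\<close> is an integer.\<close>
      then have "p i = 0" using elim(3) a(3)[of i] Ints_nonzero_abs_less1 by fastforce
      with True show ?thesis by (simp add: e_def)
    next
      case False
      have "\<bar>a i\<bar> \<ge> 1" using a(2)[of i] False by (rule Ints_nonzero_abs_ge1)
      have "\<bar>e\<bar> * \<bar>f\<bar> \<le> 1 * \<bar>f\<bar>" using e(2) by (rule mult_right_mono) simp
      also have "\<dots> \<le> \<bar>a i\<bar> * \<bar>f\<bar>" using \<open>\<bar>a i\<bar> \<ge> 1\<close> by (rule mult_right_mono) simp
      finally show ?thesis using af by linarith
    qed
    have s: "B * \<bar>a i * x i\<bar> \<le> B * s" "B * \<bar>b i * y i\<bar> \<le> B * s" "s \<ge> 0"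
      "B * \<bar>b i * y i\<bar> + B * \<bar>a i * x i\<bar> = B * s"
      using B by (auto simp: s_def algebra_simps)
    have "B * s \<ge> 0" using B s by simp
    have Ks: "K * s = \<bar>\<theta>\<bar> * (B * s) + \<bar>\<eta>\<bar> * (B * s) + B * s" by (simp add: K_def algebra_simps)
    have "\<bar>\<theta>\<bar> * (B * s) \<ge> 0" "\<bar>\<eta>\<bar> * (B * s) \<ge> 0" using \<open>B * s \<ge> 0\<close> by simp_all
    then have "B * s \<le> K * s" using Ks by linarith
    have sum: "\<bar>b i * e + a i * f\<bar> \<le> K * s" "\<bar>b i * e - a i * f\<bar> \<le> K * s"
      using be af s \<open>B * s \<le> K * s\<close> abs_mult[of "b i" e] abs_mult[of "a i" f] by linarith+
    have 1: "a i * b i * (\<theta> * \<eta>) - p i * q i = \<theta> * (a i * f) + \<eta> * (b i * e) - e * f"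
      by (simp add: e_def f_def algebra_simps)
    have "\<bar>a i * f\<bar> \<le> B * s" "\<bar>b i * e\<bar> \<le> B * s" "\<bar>e * f\<bar> \<le> B * s"
      using af be ef s unfolding abs_mult[of _ e] abs_mult[of _ f] by linarith+
    moreover from this have "\<bar>\<theta> * (a i * f)\<bar> \<le> \<bar>\<theta>\<bar> * (B * s)" "\<bar>\<eta> * (b i * e)\<bar> \<le> \<bar>\<eta>\<bar> * (B * s)"
      unfolding abs_mult[of \<theta>] abs_mult[of \<eta>] by (simp_all only: mult_left_mono abs_ge_zero)
    ultimately have "\<bar>a i * b i * (\<theta> * \<eta>) - p i * q i\<bar> \<le> K * s" unfolding 1 Ks by linarith
    moreover have "a i * b i * (\<theta> + \<eta>) - (p i * b i + a i * q i) = b i * e + a i * f"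
      "a i * b i * (\<theta> - \<eta>) - (p i * b i - a i * q i) = b i * e - a i * f"
      by (simp_all add: e_def f_def algebra_simps)
    \<comment> \<open>Since \<open>s\<close> is nonnegative its absolute value may be written around
      it; this is the shape of bound that \<open>is_dualI\<close> takes.\<close>
    ultimately show ?case using sum \<open>s \<ge> 0\<close> unfolding s_def[symmetric] by simp
  qed
  have "m \<in> hints U" "n \<in> hints U" using m n by (auto simp: dioph_decay_def dioph_def)
  then have "dual U \<theta> m = ultra_class U p" "dual U \<eta> n = ultra_class U q"
    using a(4) b(4) by (simp_all add: dual_eq)
  with a b ev show thesis by (intro that[of a b p q K]) (auto elim: eventually_mono)
qed

section \<open>Duals of products, and the product in both filtrations\<close>

lemma PP_epsE:
  assumes "\<mu> \<in> PP_eps U"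
  obtains x where "\<mu> = pp_class U (ultra_class U x)" "ultra_class U x \<in> hinfinitesimal U"
  using assms by (auto simp: PP_eps_def hinfinitesimal_def dest: ex_ultra_class_hreals)

lemma ultra_class_in_hints: "(\<And>i. a i \<in> \<int>) \<Longrightarrow> ultra_class U a \<in> hints U"
  by (auto simp: hints_def ultrapower_def)

lemma is_dualI:
  assumes "\<And>i. p i \<in> \<int>" "ultra_class U s \<in> hinfinitesimal U"
    and "eventually (\<lambda>i. \<bar>a i * \<theta> - p i\<bar> \<le> K * \<bar>s i\<bar>) U"
  shows "is_dual U \<theta> (ultra_class U a) (ultra_class U p)"
  using hinfinitesimal_bounded[OF assms(2,3)] assms(1)
  by (simp add: is_dual_def ultra_class_in_hints hop_class hconst_def)

text \<open>Let \<open>x, y, t, k\<close> represent \<mu>, \<nu>, \<iota>, \<kappa>. Then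
  \<open>mx\<close> is little-o of \<open>t\<close> and \<open>ny\<close> of \<open>k\<close>, so
  the errors are O(|t| + |k|), the class \<iota> + \<kappa>, and \<open>mnxy\<close> is little-o of
  \<open>tk\<close>.\<close>

lemma product_fine:
  assumes eps: "\<mu> \<in> PP_eps U" "\<nu> \<in> PP_eps U" "\<iota> \<in> PP_eps U" "\<kappa> \<in> PP_eps U"
    and m: "m \<in> dioph_fine U \<mu> \<iota> \<nu> \<theta>" and n: "n \<in> dioph_fine U \<nu> \<kappa> \<mu> \<eta>"
    and \<zeta>: "\<zeta> \<in> {\<theta> * \<eta>, \<theta> + \<eta>, \<theta> - \<eta>}"
  shows "hmul U m n \<in> dioph_fine U (pp_mul U \<mu> \<nu>) (pp_mul U \<iota> \<kappa>) (pp_add U \<iota> \<kappa>) \<zeta>"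
proof -
  obtain x y t k where reps: "\<mu> = pp_class U (ultra_class U x)" "\<nu> = pp_class U (ultra_class U y)"
      "\<iota> = pp_class U (ultra_class U t)" "\<kappa> = pp_class U (ultra_class U k)"
    and tk: "ultra_class U t \<in> hinfinitesimal U" "ultra_class U k \<in> hinfinitesimal U"
    using eps by (metis PP_epsE)
  have "m \<in> dioph_decay U (pp_class U (ultra_class U y)) \<theta>"
    "n \<in> dioph_decay U (pp_class U (ultra_class U x)) \<eta>"
    using m n by (auto simp: dioph_fine_def reps)
  then obtain a b p q K where mn: "m = ultra_class U a" "n = ultra_class U b"
      "dual U \<theta> m = ultra_class U p" "dual U \<eta> n = ultra_class U q"
    and ints: "\<And>i. a i \<in> \<int>" "\<And>i. b i \<in> \<int>" "\<And>i. p i \<in> \<int>" "\<And>i. q i \<in> \<int>"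
    and errors:
    "eventually (\<lambda>i. \<bar>a i * b i * (\<theta> * \<eta>) - p i * q i\<bar> \<le> K * \<bar>\<bar>a i * x i\<bar> + \<bar>b i * y i\<bar>\<bar>) U"
    "eventually (\<lambda>i. \<bar>a i * b i * (\<theta> + \<eta>) - (p i * b i + a i * q i)\<bar>
        \<le> K * \<bar>\<bar>a i * x i\<bar> + \<bar>b i * y i\<bar>\<bar>) U"
    "eventually (\<lambda>i. \<bar>a i * b i * (\<theta> - \<eta>) - (p i * b i - a i * q i)\<bar>
        \<le> K * \<bar>\<bar>a i * x i\<bar> + \<bar>b i * y i\<bar>\<bar>) U"
    by (rule product_errors) (rule that)
  \<comment> \<open>From here on only the integrality of the dual and the common error bound matter,
    so the three choices of \<zeta> are merged.\<close>
  obtain r where r: "\<And>i. r i \<in> \<int>"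
    "eventually (\<lambda>i. \<bar>a i * b i * \<zeta> - r i\<bar> \<le> K * \<bar>\<bar>a i * x i\<bar> + \<bar>b i * y i\<bar>\<bar>) U"
  proof -
    consider "\<zeta> = \<theta> * \<eta>" | "\<zeta> = \<theta> + \<eta>" | "\<zeta> = \<theta> - \<eta>" using \<zeta> by blast
    then show thesis
    proof cases
      case 1 then show thesis using errors(1) ints by (intro that[of "\<lambda>i. p i * q i"]) auto
    next
      case 2 then show thesis using errors(2) ints
        by (intro that[of "\<lambda>i. p i * b i + a i * q i"]) auto
    next
      case 3 then show thesis using errors(3) ints
        by (intro that[of "\<lambda>i. p i * b i - a i * q i"]) auto
    qed
  qed
  have ax: "eventually (\<lambda>i. c * \<bar>a i * x i\<bar> < \<bar>t i\<bar>) U"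
    and by': "eventually (\<lambda>i. c * \<bar>b i * y i\<bar> < \<bar>k i\<bar>) U" if "c > 0" for c
    using m n that by (auto simp: dioph_fine_def reps mn hints_fine_class)
  have bound: "eventually (\<lambda>i. \<bar>a i * b i * \<zeta> - r i\<bar> \<le> \<bar>K\<bar> * \<bar>\<bar>t i\<bar> + \<bar>k i\<bar>\<bar>) U"
    using r(2) ax[of 1, simplified] by'[of 1, simplified]
  proof eventually_elim
    case (elim i)
    have "K * \<bar>\<bar>a i * x i\<bar> + \<bar>b i * y i\<bar>\<bar> \<le> \<bar>K\<bar> * \<bar>\<bar>t i\<bar> + \<bar>k i\<bar>\<bar>"
      using elim by (intro mult_mono) auto
    with elim show ?case by linarith
  qed
  have ab: "ultra_class U (\<lambda>i. a i * b i) \<in> hints U"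
    by (rule ultra_class_in_hints) (simp add: ints)
  have "is_dual U \<zeta> (ultra_class U (\<lambda>i. a i * b i)) (ultra_class U r)"
    using r(1) hinfinitesimal_abs_add[OF tk] bound by (rule is_dualI)
  then have "ultra_class U (\<lambda>i. a i * b i) \<in>
      dioph_decay U (pp_class U (ultra_class U (\<lambda>i. \<bar>t i\<bar> + \<bar>k i\<bar>))) \<zeta>"
    using ab bound by (blast intro: dioph_decayI)
  \<comment> \<open>The whole constant \<open>c\<close> is spent on the first factor; the second
    only needs its bound with constant 1.\<close>
  moreover have "eventually (\<lambda>i. c * \<bar>a i * b i * (x i * y i)\<bar> < \<bar>t i * k i\<bar>) U" if "c > 0" for c
    using ax[OF that] by'[of 1, simplified]
  proof eventually_elim
    case (elim i)
    have "(c * \<bar>a i * x i\<bar>) * \<bar>b i * y i\<bar> < \<bar>t i\<bar> * \<bar>k i\<bar>"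
      using elim that by (intro mult_strict_mono') auto
    then show ?case by (simp add: abs_mult ac_simps)
  qed
  ultimately show ?thesis using ab
    by (simp add: dioph_fine_def reps mn hop_class pp_mul_class pp_add_class hints_fine_class)
qed

text \<open>Here \<open>mx\<close> and \<open>ny\<close> are themselves infinitesimal, hence so is
  the common error bound. The duals are exhibited explicitly, which yields both membership and the
  formulas.\<close>

lemma product_growth:
  assumes eps: "\<mu> \<in> PP_eps U" "\<nu> \<in> PP_eps U"
    and m: "m \<in> dioph_growth_decay U \<mu> \<nu> \<theta>" and n: "n \<in> dioph_growth_decay U \<nu> \<mu> \<eta>"
  shows "hmul U m n \<in> hints_growth U (pp_mul U \<mu> \<nu>)"
    and "is_dual U (\<theta> * \<eta>) (hmul U m n) (hmul U (dual U \<theta> m) (dual U \<eta> n))"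
    and "is_dual U (\<theta> + \<eta>) (hmul U m n) (hadd U (hmul U (dual U \<theta> m) n) (hmul U m (dual U \<eta> n)))"
    and "is_dual U (\<theta> - \<eta>) (hmul U m n) (hsub U (hmul U (dual U \<theta> m) n) (hmul U m (dual U \<eta> n)))"
proof -
  obtain x y where reps: "\<mu> = pp_class U (ultra_class U x)" "\<nu> = pp_class U (ultra_class U y)"
    using eps by (metis PP_epsE)
  have "m \<in> dioph_decay U (pp_class U (ultra_class U y)) \<theta>"
    "n \<in> dioph_decay U (pp_class U (ultra_class U x)) \<eta>"
    using m n by (auto simp: dioph_growth_decay_def reps)
  then obtain a b p q K where mn: "m = ultra_class U a" "n = ultra_class U b"
      "dual U \<theta> m = ultra_class U p" "dual U \<eta> n = ultra_class U q"
    and ints: "\<And>i. a i \<in> \<int>" "\<And>i. b i \<in> \<int>" "\<And>i. p i \<in> \<int>" "\<And>i. q i \<in> \<int>"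
    and errors:
    "eventually (\<lambda>i. \<bar>a i * b i * (\<theta> * \<eta>) - p i * q i\<bar> \<le> K * \<bar>\<bar>a i * x i\<bar> + \<bar>b i * y i\<bar>\<bar>) U"
    "eventually (\<lambda>i. \<bar>a i * b i * (\<theta> + \<eta>) - (p i * b i + a i * q i)\<bar>
        \<le> K * \<bar>\<bar>a i * x i\<bar> + \<bar>b i * y i\<bar>\<bar>) U"
    "eventually (\<lambda>i. \<bar>a i * b i * (\<theta> - \<eta>) - (p i * b i - a i * q i)\<bar>
        \<le> K * \<bar>\<bar>a i * x i\<bar> + \<bar>b i * y i\<bar>\<bar>) U"
    by (rule product_errors) (rule that)
  have inf: "ultra_class U (\<lambda>i. a i * x i) \<in> hinfinitesimal U"
    "ultra_class U (\<lambda>i. b i * y i) \<in> hinfinitesimal U"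
    using m n by (auto simp: dioph_growth_decay_def reps mn hints_growth_class)
  note s = hinfinitesimal_abs_add[OF inf]
  \<comment> \<open>One factor need only stay below 1, since the other is infinitesimal.\<close>
  have "eventually (\<lambda>i. \<bar>a i * x i\<bar> < 1) U" using inf(1) by (simp add: hinfinitesimal_class)
  then have "eventually (\<lambda>i. \<bar>a i * b i * (x i * y i)\<bar> \<le> 1 * \<bar>b i * y i\<bar>) U"
  proof eventually_elim
    case (elim i)
    then have "\<bar>a i * x i\<bar> * \<bar>b i * y i\<bar> \<le> 1 * \<bar>b i * y i\<bar>" by (intro mult_right_mono) auto
    then show ?case by (simp add: abs_mult ac_simps)
  qed
  from hinfinitesimal_bounded[OF inf(2) this] show "hmul U m n \<in> hints_growth U (pp_mul U \<mu> \<nu>)"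
    using ints by (simp add: reps mn hop_class pp_mul_class hints_growth_class ultra_class_in_hints)
  show "is_dual U (\<theta> * \<eta>) (hmul U m n) (hmul U (dual U \<theta> m) (dual U \<eta> n))"
    unfolding mn(3,4) unfolding mn hop_class
    by (rule is_dualI[OF _ s errors(1)]) (simp add: ints)
  show "is_dual U (\<theta> + \<eta>) (hmul U m n) (hadd U (hmul U (dual U \<theta> m) n) (hmul U m (dual U \<eta> n)))"
    unfolding mn(3,4) unfolding mn hop_class
    by (rule is_dualI[OF _ s errors(2)]) (simp add: ints)
  show "is_dual U (\<theta> - \<eta>) (hmul U m n) (hsub U (hmul U (dual U \<theta> m) n) (hmul U m (dual U \<eta> n)))"
    unfolding mn(3,4) unfolding mn hop_class
    by (rule is_dualI[OF _ s errors(3)]) (simp add: ints)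
qed

end

section \<open>Assembly of the inclusions and the formulas for duals\<close>

theorem theorem10:
  fixes U :: "nat filter" and \<theta> \<eta> :: real
  assumes "nonprincipal_ultrafilter U"
  shows
    "(\<forall>\<mu>\<in>PP_eps U. \<forall>\<nu>\<in>PP_eps U. \<forall>\<iota>\<in>PP_eps U. \<forall>\<kappa>\<in>PP_eps U.
        set_hmul U (dioph_fine U \<mu> \<iota> \<nu> \<theta>) (dioph_fine U \<nu> \<kappa> \<mu> \<eta>)
          \<subseteq> dioph_fine U (pp_mul U \<mu> \<nu>) (pp_mul U \<iota> \<kappa>) (pp_add U \<iota> \<kappa>) (\<theta> * \<eta>)
          \<inter> dioph_fine U (pp_mul U \<mu> \<nu>) (pp_mul U \<iota> \<kappa>) (pp_add U \<iota> \<kappa>) (\<theta> + \<eta>)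
          \<inter> dioph_fine U (pp_mul U \<mu> \<nu>) (pp_mul U \<iota> \<kappa>) (pp_add U \<iota> \<kappa>) (\<theta> - \<eta>))
   \<and> (\<forall>\<mu>\<in>PP_eps U. \<forall>\<nu>\<in>PP_eps U.
        set_hmul U (dioph_growth_decay U \<mu> \<nu> \<theta>) (dioph_growth_decay U \<nu> \<mu> \<eta>)
          \<subseteq> dioph_growth U (pp_mul U \<mu> \<nu>) (\<theta> * \<eta>)
          \<inter> dioph_growth U (pp_mul U \<mu> \<nu>) (\<theta> + \<eta>)
          \<inter> dioph_growth U (pp_mul U \<mu> \<nu>) (\<theta> - \<eta>))
   \<and> (\<forall>\<mu>\<in>PP_eps U. \<forall>\<nu>\<in>PP_eps U.
        \<forall>m\<in>dioph_growth_decay U \<mu> \<nu> \<theta>. \<forall>n\<in>dioph_growth_decay U \<nu> \<mu> \<eta>.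
          dual U (\<theta> * \<eta>) (hmul U m n) = hmul U (dual U \<theta> m) (dual U \<eta> n)
        \<and> dual U (\<theta> + \<eta>) (hmul U m n)
            = hadd U (hmul U (dual U \<theta> m) n) (hmul U m (dual U \<eta> n))
        \<and> dual U (\<theta> - \<eta>) (hmul U m n)
            = hsub U (hmul U (dual U \<theta> m) n) (hmul U m (dual U \<eta> n)))"
proof -
  interpret nonprincipal_ultra U by unfold_locales (rule assms)
  have hints: "hmul U m n \<in> hints U"
    if "\<mu> \<in> PP_eps U" "\<nu> \<in> PP_eps U" "m \<in> dioph_growth_decay U \<mu> \<nu> \<theta>" "n \<in> dioph_growth_decay U \<nu> \<mu> \<eta>"
    for \<mu> \<nu> m n
    using product_growth(1)[OF that] by (simp add: hints_growth_def)
  show ?thesis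
  proof (intro conjI ballI)
    fix \<mu> \<nu> \<iota> \<kappa>
    assume eps: "\<mu> \<in> PP_eps U" "\<nu> \<in> PP_eps U" "\<iota> \<in> PP_eps U" "\<kappa> \<in> PP_eps U"
    show "set_hmul U (dioph_fine U \<mu> \<iota> \<nu> \<theta>) (dioph_fine U \<nu> \<kappa> \<mu> \<eta>)
          \<subseteq> dioph_fine U (pp_mul U \<mu> \<nu>) (pp_mul U \<iota> \<kappa>) (pp_add U \<iota> \<kappa>) (\<theta> * \<eta>)
          \<inter> dioph_fine U (pp_mul U \<mu> \<nu>) (pp_mul U \<iota> \<kappa>) (pp_add U \<iota> \<kappa>) (\<theta> + \<eta>)
          \<inter> dioph_fine U (pp_mul U \<mu> \<nu>) (pp_mul U \<iota> \<kappa>) (pp_add U \<iota> \<kappa>) (\<theta> - \<eta>)"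
      using product_fine[OF eps] by (auto simp: set_hmul_def)
  next
    fix \<mu> \<nu> assume eps: "\<mu> \<in> PP_eps U" "\<nu> \<in> PP_eps U"
    show "set_hmul U (dioph_growth_decay U \<mu> \<nu> \<theta>) (dioph_growth_decay U \<nu> \<mu> \<eta>)
          \<subseteq> dioph_growth U (pp_mul U \<mu> \<nu>) (\<theta> * \<eta>)
          \<inter> dioph_growth U (pp_mul U \<mu> \<nu>) (\<theta> + \<eta>)
          \<inter> dioph_growth U (pp_mul U \<mu> \<nu>) (\<theta> - \<eta>)"
      \<comment> \<open>The explicit duals witness that the product lies in each
        \<open>dioph\<close> group.\<close>
      using product_growth[OF eps] hints[OF eps]
      unfolding set_hmul_def dioph_growth_def dioph_def by blast
  \<comment> \<open>Uniqueness of duals turns each exhibited dual into the value of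
    \<open>dual\<close>.\<close>
  qed (rule dual_eq, erule (3) hints, erule (3) product_growth)+
qed

end
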